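(* Let $\eta>1$. There exists a constant $C(\eta)$ depending on $\eta$ only, such that for any finite set $K$ of distinct positive integers and any sequence of reals $\{c_k, k\in K\}$, we have $$\sum_{k,\ell\in K}c_kc_\ell\,\frac{(k,\ell)^{2}}{k\ell}\ \le\ C(\eta)\sum_{\nu\in K}c_\nu^2\,(\log\log\log\nu)^{\eta}\,\Psi(\nu).$$ Further, $$\sum_{k,\ell\in K}c_kc_\ell\,\frac{(k,\ell)^{2}}{k\ell}\ \le\ C(\eta)\sum_{\nu\in K}c_\nu^2\,(\log\log\nu)^2(\log\log\log\nu)^{1+\eta}.$$
   Context: $(k,\ell)$ denotes the greatest common divisor of $k$ and $\ell$. For a positive integer $\nu$, $\Psi(\nu)=\sum_{d\mid\nu}\frac{(\log d)(\log\log d)}{d}$, the sum being over positive divisors of $\nu$. $C(\eta)$ denotes a positive constant depending only on $\eta$, possibly different in the two inequalities. Convention: $\log\log x$ equals $1$ if $0\le x\le e^{e}$, and equals $\log\log x$ in the usual sense if $x>e^{e}$; $\log\log\log x$ equals $1$ if $0\le x\le e^{e^{e}}$, and equals $\log\log\log x$ in the usual sense if $x>e^{e^{e}}$.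
   Formalization: In Ψ(ν) the factor log d is taken to be 1 for d ≤ e (only the terms d = 1 and d = 2 change), since with log 1 = 0 the first inequality fails for K = {1} and for K = {p} with p a large prime. *)

theory Defs
  imports Complex_Main
begin

(* Iterated logarithms, truncated from below to 1 near the origin.

   The truncation of log itself is needed as soon as log occurs inside a divisor sum that
   includes d = 1: with the plain value ln 1 = 0 the function Psi below would satisfy
   Psi 1 = 0 and Psi p = log p * loglog p / p (p prime), which tends to 0, while
   for K = {p}, c = 1 the quadratic form equals 1.  The bound by Psi would then fail for
   K = {1} and for K = {p} with p a large prime, whatever the constant.  Only the terms
   d = 1 and d = 2 of Psi are affected: ln d is replaced by 1. *)

definition log1 :: "real \<Rightarrow> real" where
  "log1 x = (if x \<le> exp 1 then 1 else ln x)"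

definition loglog :: "real \<Rightarrow> real" where
  "loglog x = (if x \<le> exp (exp 1) then 1 else ln (ln x))"

definition logloglog :: "real \<Rightarrow> real" where
  "logloglog x = (if x \<le> exp (exp (exp 1)) then 1 else ln (ln (ln x)))"

definition Psi :: "nat \<Rightarrow> real" where
  "Psi n = (\<Sum>d | d dvd n. log1 (real d) * loglog (real d) / real d)"

definition gcd_form :: "nat set \<Rightarrow> (nat \<Rightarrow> real) \<Rightarrow> real" where
  "gcd_form K c = (\<Sum>k\<in>K. \<Sum>l\<in>K. c k * c l * ((real (gcd k l))\<^sup>2 / (real k * real l)))"

end

theory Submission
  imports Defs "HOL-Number_Theory.Prime_Powers" "HOL-Analysis.Harmonic_Numbers"
begin

text \<open>
  Put \<open>w m = log m * loglog m * (logloglog m) powr \<eta>\<close>. The series of \<open>1 / (m * w m)\<close> converges, if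
  only just, because \<open>\<eta> > 1\<close> (\<open>summable_triple_log\<close>). Since \<open>(k, l)\<^sup>2\<close> is one of the
  terms of the sum of \<open>d\<^sup>2\<close> over the common divisors \<open>d\<close> of \<open>k\<close> and \<open>l\<close>, the quadratic form is at
  most the sum over \<open>d\<close> of the squares of \<open>\<Sum> \<bar>c (d m)\<bar> / m\<close>, with \<open>m\<close> running over the \<open>m\<close> such
  that \<open>d m\<close> is in \<open>K\<close>. Cauchy's inequality with the weight \<open>w\<close> bounds each square by the sum of
  the convergent series times \<open>\<Sum> c (d m)\<^sup>2 * w m / m\<close>, and collecting the terms with \<open>d m = n\<close>
  gives \<open>\<Sum> c n\<^sup>2 * (\<Sum>m | m dvd n. w m / m)\<close> (\<open>gcd_form_le_weighted\<close>). In the inner sum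
  \<open>logloglog m\<close> is at most \<open>logloglog n\<close>, and what remains is \<open>Psi n\<close>: this is the first inequality.

  The second one follows from \<open>Psi n = O((loglog n)\<^sup>2 * logloglog n)\<close> (\<open>Psi_le\<close>). Everything here
  rests on \<open>A = \<Sum> \<Lambda>(q) / q\<close>, the sum being over the divisors \<open>q\<close> of \<open>n\<close>, where \<open>\<Lambda>\<close> is the von
  Mangoldt function. One has \<open>A = O(loglog n)\<close>: the \<open>q\<close> up to about \<open>log n\<close> contribute
  \<open>O(loglog n)\<close> by the easy half of a theorem of Mertens, and the larger ones contribute at most
  \<open>(\<Sum> \<Lambda>(q)) / log n = 1\<close>. Now attach the weights \<open>1 / d\<close> to the divisors \<open>d\<close> of \<open>n\<close>, of total mass
  \<open>F\<close>. Expanding \<open>log d\<close> as the sum of \<open>\<Lambda>(q)\<close> over the divisors \<open>q\<close> of \<open>d\<close> shows that the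
  average of \<open>log d\<close> is at most \<open>A\<close> (\<open>divsum_ln_le\<close>). By Markov's inequality at least half of the
  mass therefore sits on \<open>d \<le> exp (2 A + 1)\<close>, where the harmonic series bounds it by \<open>O(1 + A)\<close>; so
  \<open>F = O(loglog n)\<close> (\<open>divsum_one_le\<close>). By concavity the average of
  \<open>loglog d\<close> is \<open>O(log A) = O(logloglog n)\<close>. Finally the same expansion of \<open>log d\<close> inside \<open>Psi n\<close>,
  together with \<open>loglog (q e) \<le> loglog q + loglog e\<close> for a suitably smoothed \<open>loglog\<close>, separates
  \<open>Psi n\<close> into products of these quantities (\<open>divsum_ln_mult_le\<close>).
\<close>

section \<open>Iterated logarithms\<close>

lemma less_ln_if_exp_less:
  fixes a x :: real
  assumes "exp a < x"
  shows "a < ln x"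
proof -
  have "0 < x" using assms exp_gt_zero order_less_trans by blast
  then show ?thesis using assms by (metis exp_gt_zero ln_exp ln_less_cancel_iff)
qed

lemma log1_ge_1: "1 \<le> log1 x"
  using less_ln_if_exp_less[of 1 x] by (auto simp: log1_def)

lemma loglog_ge_1: "1 \<le> loglog x"
proof (cases "x \<le> exp (exp 1)")
  case False
  then have "exp (exp 1) < x" by simp
  then have "exp 1 < ln x" by (rule less_ln_if_exp_less)
  then have "1 < ln (ln x)" by (rule less_ln_if_exp_less)
  then show ?thesis using False by (simp add: loglog_def)
qed (simp add: loglog_def)

lemma logloglog_ge_1: "1 \<le> logloglog x"
proof (cases "x \<le> exp (exp (exp 1))")
  case False
  then have "exp (exp (exp 1)) < x" by simp
  then have "exp (exp 1) < ln x" by (rule less_ln_if_exp_less)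
  then have "exp 1 < ln (ln x)" by (rule less_ln_if_exp_less)
  then have "1 < ln (ln (ln x))" by (rule less_ln_if_exp_less)
  then show ?thesis using False by (simp add: logloglog_def)
qed (simp add: logloglog_def)

lemma logloglog_mono: "x \<le> y \<Longrightarrow> logloglog x \<le> logloglog y"
proof (cases "x \<le> exp (exp (exp 1))")
  case True
  then show ?thesis using logloglog_ge_1[of y] by (simp add: logloglog_def)
next
  case False
  assume xy: "x \<le> y"
  have "exp (exp (exp 1)) < x" using False by simp
  then have 1: "exp (exp 1) < ln x" by (rule less_ln_if_exp_less)
  then have 2: "exp 1 < ln (ln x)" by (rule less_ln_if_exp_less)
  have pos: "0 < x" "0 < ln x" "0 < ln (ln x)"
    using False 1 2 by (smt (verit) exp_gt_zero)+
  have "ln (ln (ln x)) \<le> ln (ln (ln y))"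
    using pos xy by (intro ln_mono) auto
  then show ?thesis using False xy by (simp add: logloglog_def)
qed

text \<open>
  Each truncated logarithm is related to the next one by an inequality that holds for the small and
  the large values of \<open>x\<close> alike. This allows a uniform estimate of \<open>Psi\<close>.
\<close>

lemma ln_le_exp_loglog:
  assumes "x > 0"
  shows "ln x \<le> exp (loglog x)"
proof (cases "x \<le> exp (exp 1)")
  case True
  then have "ln x \<le> exp 1" using assms by (metis ln_exp ln_mono)
  then show ?thesis using True by (simp add: loglog_def)
next
  case False
  then have "exp (exp 1) < x" by simp
  then have "exp 1 < ln x" by (rule less_ln_if_exp_less)
  then have "0 < ln x" by (smt (verit) exp_gt_zero)
  then show ?thesis using False by (simp add: loglog_def)
qed

lemma loglog_le_exp_logloglog: "loglog x \<le> exp (logloglog x)"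
proof (cases "x \<le> exp (exp (exp 1))")
  case True
  show ?thesis
  proof (cases "x \<le> exp (exp 1)")
    case True
    have "1 \<le> exp (logloglog x)" using logloglog_ge_1[of x] by simp
    then show ?thesis using True by (simp add: loglog_def)
  next
    case False
    then have e: "exp (exp 1) < x" by simp
    then have 1: "exp 1 < ln x" by (rule less_ln_if_exp_less)
    have x0: "0 < x" "0 < ln x" using e 1 by (smt (verit) exp_gt_zero)+
    have "ln x \<le> exp (exp 1)" using True x0 by (metis ln_exp ln_mono)
    then have "ln (ln x) \<le> exp 1" using x0 by (metis ln_exp ln_mono)
    then show ?thesis using True False by (simp add: loglog_def logloglog_def)
  qed
next
  case False
  then have "exp (exp (exp 1)) < x" by simp
  then have 1: "exp (exp 1) < ln x" by (rule less_ln_if_exp_less)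
  then have 2: "exp 1 < ln (ln x)" by (rule less_ln_if_exp_less)
  then have "0 < ln (ln x)" by (smt (verit) exp_gt_zero)
  moreover have "exp (exp 1) \<le> exp (exp (exp (1::real)))" by (simp add: order.trans[OF exp_ge_add_one_self])
  then have "\<not> x \<le> exp (exp 1)" using False by linarith
  ultimately show ?thesis using False by (simp add: loglog_def logloglog_def)
qed

section \<open>Divisor sums and the von Mangoldt function\<close>

text \<open>
  All divisor sums below carry the weight \<open>1 / d\<close>: \<open>divsum (\<lambda>_. 1) n\<close> is \<open>\<sigma>(n) / n\<close>, and the
  quotient \<open>divsum f n / divsum (\<lambda>_. 1) n\<close> is the average of \<open>f\<close> for the probability on the
  divisors of \<open>n\<close> proportional to \<open>1 / d\<close>.
\<close>

definition divsum :: "(nat \<Rightarrow> real) \<Rightarrow> nat \<Rightarrow> real" where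
  "divsum f n = (\<Sum>d | d dvd n. f d / real d)"

lemma divsum_mono:
  assumes "\<And>d. d dvd n \<Longrightarrow> f d \<le> g d"
  shows "divsum f n \<le> divsum g n"
  unfolding divsum_def by (intro sum_mono divide_right_mono) (use assms in auto)

lemma divsum_nonneg: "(\<And>d. d dvd n \<Longrightarrow> 0 \<le> f d) \<Longrightarrow> 0 \<le> divsum f n"
  unfolding divsum_def by (intro sum_nonneg divide_nonneg_nonneg) auto

lemma divsum_add: "divsum (\<lambda>d. f d + g d) n = divsum f n + divsum g n"
  by (simp add: divsum_def add_divide_distrib sum.distrib)

lemma divsum_scale: "divsum (\<lambda>d. a * f d) n = a * divsum f n"
  by (simp add: divsum_def sum_distrib_left)

lemma divisor_pos: "d dvd n \<Longrightarrow> n > 0 \<Longrightarrow> d > (0::nat)"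
  by (auto intro: Nat.gr0I)

text \<open>
  The upper half of Mertens' first theorem, up to a constant factor. Summing
  \<open>ln m = \<Sum>q | q dvd m. \<Lambda>(q)\<close> over \<open>m \<le> N\<close> gives \<open>ln (N!) = \<Sum>q. \<Lambda>(q) * \<lfloor>N / q\<rfloor>\<close>. The crude bounds
  \<open>\<lfloor>t\<rfloor> \<ge> t / 2\<close> for \<open>t \<ge> 1\<close> and \<open>N! \<le> N ^ N\<close> do the rest.
\<close>

lemma sum_mangoldt_over_le:
  assumes "N > 0"
  shows "(\<Sum>q=1..N. mangoldt q / real q) \<le> 2 * ln (real N)"
proof -
  have card_ge: "real N / (2 * real q) \<le> real (card {m \<in> {1..N}. q dvd m})" if q: "q \<in> {1..N}" for q
  proof -
    have "(\<lambda>i. q * i) ` {1..N div q} \<subseteq> {m \<in> {1..N}. q dvd m}"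
    proof (intro image_subsetI CollectI conjI)
      fix i assume i: "i \<in> {1..N div q}"
      have "q * i \<le> q * (N div q)" using i by (intro mult_left_mono) auto
      also have "\<dots> \<le> N" by simp
      finally show "q * i \<in> {1..N}" using i q by auto
    qed auto
    then have "card ((\<lambda>i. q * i) ` {1..N div q}) \<le> card {m \<in> {1..N}. q dvd m}"
      by (intro card_mono) auto
    moreover have "card ((\<lambda>i. q * i) ` {1..N div q}) = N div q"
      using q by (subst card_image) (auto simp: inj_on_def)
    ultimately have c: "N div q \<le> card {m \<in> {1..N}. q dvd m}" by simp
    have "N div q \<ge> 1" using q by (simp add: div_greater_zero_iff Suc_le_eq)
    moreover have "N mod q < q" using q by simp
    moreover have "N = q * (N div q) + N mod q" by simp
    ultimately have "N \<le> 2 * q * (N div q)"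
      using mult_le_mono2[of 1 "N div q" q] by linarith
    then have "N \<le> card {m \<in> {1..N}. q dvd m} * (2 * q)"
      using c by (metis mult.commute mult_le_mono2 order_trans)
    then have "real N \<le> real (card {m \<in> {1..N}. q dvd m} * (2 * q))"
      by (simp only: of_nat_le_iff)
    then have "real N \<le> real (card {m \<in> {1..N}. q dvd m}) * (2 * real q)"
      by simp
    then show ?thesis using q by (simp add: divide_simps)
  qed
  have "real N * (\<Sum>q=1..N. mangoldt q / real q) / 2
      = (\<Sum>q=1..N. mangoldt q * (real N / (2 * real q)))"
    by (simp add: sum_distrib_left sum_divide_distrib field_simps)
  also have "\<dots> \<le> (\<Sum>q=1..N. mangoldt q * real (card {m \<in> {1..N}. q dvd m}))"
    by (intro sum_mono mult_left_mono card_ge mangoldt_nonneg)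
  also have "\<dots> = (\<Sum>q=1..N. \<Sum>m | m \<in> {1..N} \<and> q dvd m. mangoldt q)"
    by (simp add: mult.commute)
  also have "\<dots> = (\<Sum>m=1..N. \<Sum>q | q \<in> {1..N} \<and> q dvd m. mangoldt q)"
    by (rule sum.swap_restrict) auto
  also have "\<dots> = (\<Sum>m=1..N. ln (real m))"
  proof (intro sum.cong refl)
    fix m assume m: "m \<in> {1..N}"
    then have "{q. q \<in> {1..N} \<and> q dvd m} = {q. q dvd m}"
      by (auto dest: dvd_imp_le divisor_pos simp: Suc_le_eq)
    then show "(\<Sum>q | q \<in> {1..N} \<and> q dvd m. mangoldt q) = ln (real m)"
      using m mangoldt_sum[of m, where 'a = real] by simp
  qed
  also have "\<dots> \<le> (\<Sum>m=1..N. ln (real N))"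
    by (intro sum_mono) auto
  finally show ?thesis using assms by (simp add: field_simps)
qed

text \<open>
  The divisors \<open>q \<le> N\<close> are compared with all integers up to \<open>N\<close>. For the others, \<open>h q / q\<close> is pulled
  out at the cost of \<open>H / N\<close>, and \<open>\<Lambda>\<close> sums to \<open>ln n \<le> N\<close> over the divisors of \<open>n\<close>. The lemma is used
  for \<open>h = 1\<close> and for a smoothed \<open>loglog\<close>.
\<close>

lemma divsum_mangoldt_le:
  assumes n: "n > 0" and N: "N > 0" "ln (real n) \<le> real N" and H: "0 \<le> H"
    and small: "\<And>q. 0 < q \<Longrightarrow> q \<le> N \<Longrightarrow> h q \<le> H"
    and large: "\<And>q. N < q \<Longrightarrow> h q / real q \<le> H / real N"
  shows "divsum (\<lambda>q. mangoldt q * h q) n \<le> H * (2 * ln (real N) + 1)"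
proof -
  have fin: "finite {q. q dvd n}" using n by simp
  have "divsum (\<lambda>q. mangoldt q * h q) n
     \<le> (\<Sum>q | q dvd n. H * (if q \<le> N then mangoldt q / real q else 0) + H / N * mangoldt q)"
    unfolding divsum_def
  proof (intro sum_mono)
    fix q assume q: "q \<in> {q. q dvd n}"
    then have q0: "q > 0" using n divisor_pos by auto
    show "mangoldt q * h q / real q \<le> H * (if q \<le> N then mangoldt q / real q else 0) + H / N * mangoldt q"
    proof (cases "q \<le> N")
      case True
      have "mangoldt q * h q / real q \<le> mangoldt q * H / real q"
        using small[OF q0 True] by (intro divide_right_mono mult_left_mono mangoldt_nonneg) auto
      moreover have "0 \<le> H / N * mangoldt q" using H mangoldt_nonneg by simp
      ultimately show ?thesis using True by (simp add: mult.commute)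
    next
      case False
      have "mangoldt q * (h q / real q) \<le> mangoldt q * (H / real N)"
        using large False by (intro mult_left_mono mangoldt_nonneg) auto
      then show ?thesis using False by (simp add: mult.commute)
    qed
  qed
  also have "\<dots> = H * (\<Sum>q | q dvd n. if q \<le> N then mangoldt q / real q else 0) + H / N * (\<Sum>q | q dvd n. mangoldt q)"
    by (simp add: sum.distrib sum_distrib_left)
  also have "(\<Sum>q | q dvd n. mangoldt q) = ln (real n)"
    using mangoldt_sum[of n, where 'a = real] n by simp
  also have "(\<Sum>q | q dvd n. if q \<le> N then mangoldt q / real q else 0)
       = (\<Sum>q\<in>{q \<in> {q. q dvd n}. q \<le> N}. mangoldt q / real q)"
    by (rule sum.inter_filter[symmetric, OF fin])
  also have "H * \<dots> \<le> H * (\<Sum>q=1..N. mangoldt q / real q)"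
    using n H by (intro mult_left_mono sum_mono2) (auto dest: divisor_pos simp: mangoldt_nonneg Suc_le_eq)
  also have "\<dots> \<le> H * (2 * ln (real N))"
    using H N by (intro mult_left_mono sum_mangoldt_over_le)
  also have "H / N * ln (real n) \<le> H / N * N"
    using H N by (intro mult_left_mono) auto
  finally show ?thesis using N by (simp add: algebra_simps)
qed

text \<open>
  In \<open>ln d = \<Sum>q | q dvd d. \<Lambda>(q)\<close> write \<open>d = q * e\<close>: the weight \<open>1 / d\<close> splits as
  \<open>(1 / q) * (1 / e)\<close>, and \<open>h d\<close> splits by subadditivity. Letting \<open>e\<close> run over all divisors of \<open>n\<close>,
  not just those of \<open>n / q\<close>, makes the two variables independent. The separate function \<open>g\<close> allows the
  choice \<open>h = 1\<close>, \<open>g = 0\<close>, which bounds the average of \<open>ln d\<close> by \<open>divsum mangoldt n\<close>.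
\<close>

lemma divsum_ln_mult_le:
  assumes n: "n > 0" and h: "\<And>d. 0 < d \<Longrightarrow> 0 \<le> h d"
    and sub: "\<And>a b. 0 < a \<Longrightarrow> 0 < b \<Longrightarrow> h (a * b) \<le> g a + h b"
  shows "divsum (\<lambda>d. ln (real d) * h d) n
     \<le> divsum (\<lambda>q. mangoldt q * g q) n * divsum (\<lambda>_. 1) n + divsum mangoldt n * divsum h n"
proof -
  have fin: "finite {q. q dvd n}" using n by simp
  have inner: "(\<Sum>d | d dvd n \<and> q dvd d. h d / real d)
       \<le> g q / real q * divsum (\<lambda>_. 1) n + divsum h n / real q" if q: "q dvd n" for q
  proof -
    have q0: "q > 0" using divisor_pos n q by auto
    have eq: "{d. d dvd n \<and> q dvd d} = (\<lambda>e. q * e) ` {e. q * e dvd n}" by auto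
    have "(\<Sum>d | d dvd n \<and> q dvd d. h d / real d) = (\<Sum>e | q * e dvd n. h (q * e) / real (q * e))"
      unfolding eq using q0 by (subst sum.reindex) (auto simp: inj_on_def)
    also have "\<dots> \<le> (\<Sum>e | e dvd n. h (q * e) / real (q * e))"
      using fin n q0 by (intro sum_mono2 divide_nonneg_nonneg h) (auto dest: dvd_mult_right divisor_pos)
    also have "\<dots> \<le> (\<Sum>e | e dvd n. (g q + h e) / real (q * e))"
      using q0 n by (intro sum_mono divide_right_mono sub) (auto dest: divisor_pos)
    also have "\<dots> = g q / real q * divsum (\<lambda>_. 1) n + divsum h n / real q"
      unfolding divsum_def
      by (simp add: sum_distrib_left sum_divide_distrib add_divide_distrib sum.distrib mult.commute)
    finally show ?thesis .
  qed
  have "divsum (\<lambda>d. ln (real d) * h d) n = (\<Sum>d | d dvd n. \<Sum>q | q dvd n \<and> q dvd d. mangoldt q * (h d / real d))"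
    unfolding divsum_def
  proof (intro sum.cong refl)
    fix d assume d: "d \<in> {d. d dvd n}"
    then have "{q. q dvd n \<and> q dvd d} = {q. q dvd d}" by (auto intro: dvd_trans)
    moreover have "(\<Sum>q | q dvd d. mangoldt q) = ln (real d)"
      using d n mangoldt_sum[of d, where 'a = real] by auto
    moreover have "(\<Sum>q | q dvd d. mangoldt q * (h d / real d)) = (\<Sum>q | q dvd d. mangoldt q) * (h d / real d)"
      by (rule sum_distrib_right[symmetric])
    ultimately show "ln (real d) * h d / real d = (\<Sum>q | q dvd n \<and> q dvd d. mangoldt q * (h d / real d))"
      by simp
  qed
  also have "\<dots> = (\<Sum>q | q dvd n. \<Sum>d | d dvd n \<and> q dvd d. mangoldt q * (h d / real d))"
    using sum.swap_restrict[OF fin fin, where R = "\<lambda>d q. q dvd d"] by auto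
  also have "\<dots> = (\<Sum>q | q dvd n. mangoldt q * (\<Sum>d | d dvd n \<and> q dvd d. h d / real d))"
    by (simp add: sum_distrib_left)
  also have "\<dots> \<le> (\<Sum>q | q dvd n. mangoldt q * (g q / real q * divsum (\<lambda>_. 1) n + divsum h n / real q))"
    by (intro sum_mono mult_left_mono inner mangoldt_nonneg) auto
  also have "\<dots> = divsum (\<lambda>q. mangoldt q * g q) n * divsum (\<lambda>_. 1) n + divsum mangoldt n * divsum h n"
    by (simp add: divsum_def[of "\<lambda>q. mangoldt q * g q"] divsum_def[of mangoldt] sum_distrib_right
        sum_distrib_left sum_divide_distrib distrib_left sum.distrib mult.assoc)
  finally show ?thesis .
qed

corollary divsum_ln_le:
  assumes "n > 0"
  shows "divsum (\<lambda>d. ln (real d)) n \<le> divsum mangoldt n * divsum (\<lambda>_. 1) n"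
  using divsum_ln_mult_le[OF assms, of "\<lambda>_. 1" "\<lambda>_. 0"] by (simp add: divsum_def)

text \<open>
  Markov's inequality: as the average of \<open>ln d\<close> is at most \<open>A = divsum mangoldt n\<close>, the divisors with
  \<open>ln d > T\<close>, where \<open>T = 2 * A + 1\<close>, carry at most half of the total mass \<open>F\<close>, while the others carry
  at most a partial sum of the harmonic series, which is at most \<open>1 + T\<close>.
\<close>

lemma divsum_one_le:
  assumes n: "n > 0"
  shows "divsum (\<lambda>_. 1) n \<le> 4 * (1 + divsum mangoldt n)"
proof -
  define A where "A = divsum mangoldt n"
  \<comment> \<open>the summand 1 keeps \<open>T\<close> positive when \<open>A = 0\<close>, that is for \<open>n = 1\<close>\<close>
  define T where "T = 2 * A + 1"
  have A: "A \<ge> 0" unfolding A_def by (intro divsum_nonneg mangoldt_nonneg)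
  then have T: "T \<ge> 1" by (simp add: T_def)
  define F where "F = divsum (\<lambda>_. 1) n"
  have F: "F \<ge> 0" unfolding F_def by (intro divsum_nonneg) auto
  have fin: "finite {q. q dvd n}" using n by simp
  define M where "M = nat \<lfloor>exp T\<rfloor>"
  have eT: "1 \<le> exp T" using T by simp
  have M0: "M > 0" unfolding M_def using eT by (simp add: le_floor_iff)
  have MT: "real M \<le> exp T" unfolding M_def using eT by simp
  have "F \<le> (\<Sum>d | d dvd n. (if d \<le> M then 1 / real d else 0) + 1 / T * (ln (real d) / real d))"
    unfolding F_def divsum_def
  proof (intro sum_mono)
    fix d assume d: "d \<in> {d. d dvd n}"
    then have d0: "d > 0" using n divisor_pos by auto
    show "1 / real d \<le> (if d \<le> M then 1 / real d else 0) + 1 / T * (ln (real d) / real d)"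
    proof (cases "d \<le> M")
      case True then show ?thesis using T d0 by simp
    next
      case False
      then have "exp T < real d" unfolding M_def using eT by linarith
      then have "T \<le> ln (real d)" using d0 by (simp add: ln_ge_iff)
      then show ?thesis using False T d0 by (simp add: divide_simps)
    qed
  qed
  also have "\<dots> = (\<Sum>d | d dvd n. if d \<le> M then 1 / real d else 0) + 1 / T * divsum (\<lambda>d. ln (real d)) n"
    by (simp add: sum.distrib sum_distrib_left divsum_def)
  also have "(\<Sum>d | d dvd n. if d \<le> M then 1 / real d else 0) = (\<Sum>d\<in>{d \<in> {d. d dvd n}. d \<le> M}. 1 / real d)"
    by (rule sum.inter_filter[symmetric, OF fin])
  also have "\<dots> \<le> (\<Sum>d=1..M. 1 / real d)"
    using n by (intro sum_mono2) (auto dest: divisor_pos simp: Suc_le_eq)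
  also have "\<dots> = harm M" by (simp add: harm_def inverse_eq_divide)
  also have "\<dots> \<le> 1 + ln (real M)"
    using euler_mascheroni_sequence_decreasing[of 1 M] M0 by (simp add: harm_def)
  also have "ln (real M) \<le> T" using M0 MT by (metis ln_exp ln_mono of_nat_0_less_iff)
  also have "1 / T * divsum (\<lambda>d. ln (real d)) n \<le> 1 / T * (A * F)"
    unfolding A_def F_def using T n by (intro mult_left_mono divsum_ln_le) auto
  also have "\<dots> \<le> F / 2"
  proof -
    have "2 * (A * F) \<le> T * F" using F by (simp add: T_def distrib_right)
    then show ?thesis using T by (simp add: field_simps)
  qed
  finally show ?thesis by (simp add: T_def F_def A_def)
qed


section \<open>The size of \<open>Psi\<close>\<close>

text \<open>
  An upper bound for \<open>loglog\<close> on the positive integers that is subadditive with respect to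
  multiplication, has \<open>smooth_loglog d / d\<close> decreasing and is a concave function of \<open>ln d\<close>. The
  constant \<open>3\<close> makes its values at least \<open>1\<close>, which is the value of \<open>loglog\<close> near the origin.
\<close>

definition smooth_loglog :: "nat \<Rightarrow> real" where
  "smooth_loglog d = ln (3 + ln (real d))"

lemma one_le_ln_three: "1 \<le> ln (3::real)"
  using e_less_272 by (subst ln_ge_iff) auto

lemma three_plus_ln_pos: "0 < d \<Longrightarrow> 0 < 3 + ln (real d)"
  by (simp add: add_pos_nonneg)

lemma smooth_loglog_mono: "0 < a \<Longrightarrow> a \<le> b \<Longrightarrow> smooth_loglog a \<le> smooth_loglog b"
  unfolding smooth_loglog_def by (intro ln_mono three_plus_ln_pos) auto

lemma smooth_loglog_ge_1: "0 < d \<Longrightarrow> 1 \<le> smooth_loglog d"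
  using smooth_loglog_mono[of 1 d] one_le_ln_three by (simp add: smooth_loglog_def)

lemma smooth_loglog_mult_le:
  assumes "0 < a" "0 < b"
  shows "smooth_loglog (a * b) \<le> smooth_loglog a + smooth_loglog b"
proof -
  have l: "0 \<le> ln (real a)" "0 \<le> ln (real b)" using assms by auto
  have "3 + ln (real (a * b)) \<le> (3 + ln (real a)) * (3 + ln (real b))"
    using assms l by (simp add: ln_mult algebra_simps)
  then have "smooth_loglog (a * b) \<le> ln ((3 + ln (real a)) * (3 + ln (real b)))"
    unfolding smooth_loglog_def using assms by (intro ln_mono three_plus_ln_pos) auto
  also have "\<dots> = smooth_loglog a + smooth_loglog b"
    unfolding smooth_loglog_def using l by (intro ln_mult_pos) auto
  finally show ?thesis .
qed

lemma smooth_loglog_quotient_antimono: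
  assumes "0 < a" "a \<le> b"
  shows "smooth_loglog b / real b \<le> smooth_loglog a / real a"
proof -
  define r where "r = real b / real a"
  have r: "r \<ge> 1" using assms by (simp add: r_def)
  have la: "0 \<le> ln (real a)" using assms by auto
  have lr: "0 \<le> ln r" using r by auto
  have b: "real b = real a * r" using assms by (simp add: r_def)
  have "3 + ln (real b) = 3 + ln (real a) + ln r"
    unfolding b using assms r by (simp add: ln_mult)
  also have "\<dots> \<le> (3 + ln (real a)) * (1 + ln r)"
    using la lr by (simp add: algebra_simps)
  finally have "smooth_loglog b \<le> ln ((3 + ln (real a)) * (1 + ln r))"
    unfolding smooth_loglog_def using assms by (intro ln_mono three_plus_ln_pos) auto
  also have "\<dots> = smooth_loglog a + ln (1 + ln r)"
    unfolding smooth_loglog_def using la lr by (intro ln_mult_pos) auto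
  also have "ln (1 + ln r) \<le> ln r" using lr by (rule ln_add_one_self_le_self)
  also have "ln r \<le> 1 * (r - 1)" using r ln_le_minus_one[of r] by simp
  also have "1 * (r - 1) \<le> smooth_loglog a * (r - 1)"
    using smooth_loglog_ge_1[OF assms(1)] r by (intro mult_right_mono) auto
  finally have "smooth_loglog b \<le> smooth_loglog a * r" by (simp add: algebra_simps)
  then show ?thesis using assms r by (simp add: b field_simps)
qed

lemma loglog_le_smooth_loglog: "0 < d \<Longrightarrow> loglog (real d) \<le> smooth_loglog d"
proof (cases "real d \<le> exp (exp 1)")
  case False
  then have d: "exp (exp 1) < real d" by simp
  then have "exp 1 < ln (real d)" by (rule less_ln_if_exp_less)
  moreover have "0 < exp (1::real)" by simp
  ultimately have "0 < ln (real d)" by linarith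
  then have "ln (ln (real d)) \<le> ln (3 + ln (real d))" by (intro ln_mono) auto
  then show ?thesis using False by (simp add: loglog_def smooth_loglog_def)
qed (simp add: loglog_def smooth_loglog_ge_1)

text \<open>
  Jensen's inequality: \<open>ln (3 + t)\<close> is concave and the average of \<open>t = ln d\<close> is at most
  \<open>A = divsum mangoldt n\<close>. It is proved by replacing \<open>ln (3 + t)\<close> by its tangent at \<open>t = A\<close>.
\<close>

lemma divsum_smooth_loglog_le:
  assumes n: "n > 0"
  shows "divsum smooth_loglog n \<le> divsum (\<lambda>_. 1) n * ln (3 + divsum mangoldt n)"
proof -
  define A where "A = divsum mangoldt n"
  have A: "A \<ge> 0" unfolding A_def by (intro divsum_nonneg mangoldt_nonneg)
  have "divsum smooth_loglog n \<le> divsum (\<lambda>d. (ln (3 + A) + 3 / (3 + A) - 1) * 1 + 1 / (3 + A) * ln (real d)) n"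
  proof (rule divsum_mono)
    fix d assume "d dvd n"
    then have "d > 0" using n divisor_pos by auto
    then have l: "0 \<le> ln (real d)" by auto
    have "smooth_loglog d - ln (3 + A) = ln ((3 + ln (real d)) / (3 + A))"
      unfolding smooth_loglog_def using l A by (subst ln_div) auto
    also have "\<dots> \<le> (3 + ln (real d)) / (3 + A) - 1"
      using l A by (intro ln_le_minus_one) auto
    finally show "smooth_loglog d \<le> (ln (3 + A) + 3 / (3 + A) - 1) * 1 + 1 / (3 + A) * ln (real d)"
      by (simp add: add_divide_distrib)
  qed
  also have "\<dots> = (ln (3 + A) + 3 / (3 + A) - 1) * divsum (\<lambda>_. 1) n + 1 / (3 + A) * divsum (\<lambda>d. ln (real d)) n"
    by (simp only: divsum_add divsum_scale)
  also have "\<dots> \<le> (ln (3 + A) + 3 / (3 + A) - 1) * divsum (\<lambda>_. 1) n + 1 / (3 + A) * (A * divsum (\<lambda>_. 1) n)"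
    unfolding A_def using A n by (intro add_left_mono mult_left_mono divsum_ln_le) (auto simp: A_def)
  also have "\<dots> = divsum (\<lambda>_. 1) n * ln (3 + A)"
  proof -
    have "3 / (3 + A) + A / (3 + A) = 1" using A by (simp flip: add_divide_distrib)
    moreover have "(ln (3 + A) + 3 / (3 + A) - 1) * F + 1 / (3 + A) * (A * F)
        = F * ln (3 + A) + (3 / (3 + A) + A / (3 + A) - 1) * F" for F :: real
      by (simp add: algebra_simps)
    ultimately show ?thesis by simp
  qed
  finally show ?thesis unfolding A_def .
qed

lemma Psi_le_divsum:
  assumes n: "n > 0"
  shows "Psi n \<le> divsum smooth_loglog n + divsum (\<lambda>d. ln (real d) * smooth_loglog d) n"
proof -
  have "Psi n = divsum (\<lambda>d. log1 (real d) * loglog (real d)) n"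
    by (simp add: Psi_def divsum_def)
  also have "\<dots> \<le> divsum (\<lambda>d. smooth_loglog d + ln (real d) * smooth_loglog d) n"
  proof (rule divsum_mono)
    fix d assume "d dvd n"
    then have d: "d > 0" using n divisor_pos by auto
    have "log1 (real d) * loglog (real d) \<le> (1 + ln (real d)) * smooth_loglog d"
      using d smooth_loglog_ge_1[OF d]
        order.trans[OF zero_le_one loglog_ge_1]
      by (intro mult_mono loglog_le_smooth_loglog) (auto simp: log1_def)
    then show "log1 (real d) * loglog (real d) \<le> smooth_loglog d + ln (real d) * smooth_loglog d"
      by (simp add: algebra_simps)
  qed
  finally show ?thesis by (simp add: divsum_add)
qed

text \<open>
  With \<open>L = loglog n\<close> and \<open>L3 = logloglog n\<close>, the preceding lemmas give \<open>A = O(L)\<close>, \<open>F = O(L)\<close>,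
  \<open>B = O(L * L3)\<close> and \<open>H = O(L * L3)\<close>, and \<open>Psi n\<close> is at most \<open>B + H * F + A * B\<close>. The numerical
  constants come from the crude bound \<open>ln x \<le> x - 1\<close>.
\<close>

lemma Psi_le:
  assumes n: "n > 0"
  shows "Psi n \<le> 4000 * (loglog (real n))\<^sup>2 * logloglog (real n)"
proof -
  define L where "L = loglog (real n)"
  define L3 where "L3 = logloglog (real n)"
  \<comment> \<open>the cutoff for the prime powers dividing \<open>n\<close>, of the order of \<open>ln n\<close>\<close>
  define N where "N = nat \<lceil>ln (real n)\<rceil> + 2"
  define A where "A = divsum mangoldt n"
  define H where "H = divsum (\<lambda>q. mangoldt q * smooth_loglog q) n"
  define F where "F = divsum (\<lambda>_. 1) n"
  define B where "B = divsum smooth_loglog n"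
  have L: "1 \<le> L" and L3: "1 \<le> L3" and LL3: "L \<le> exp L3" and lnL: "ln (real n) \<le> exp L"
    using loglog_ge_1 logloglog_ge_1 loglog_le_exp_logloglog ln_le_exp_loglog n
    by (auto simp: L_def L3_def)
  have lnL3: "ln L \<le> L3" using LL3 L by (metis ln_exp ln_mono less_le_trans zero_less_one)
  have A0: "0 \<le> A" unfolding A_def by (intro divsum_nonneg mangoldt_nonneg)
  have F0: "0 \<le> F" unfolding F_def by (intro divsum_nonneg) auto
  have B0: "0 \<le> B" unfolding B_def using n
    by (intro divsum_nonneg) (meson divisor_pos order.trans smooth_loglog_ge_1 zero_le_one)
  have N0: "N > 0" by (simp add: N_def)
  have lnn: "0 \<le> ln (real n)" using n by auto
  then have Nge: "ln (real n) \<le> real N" and Nle: "real N \<le> ln (real n) + 3"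
    unfolding N_def by linarith+
  have "2 \<le> exp L" using L exp_ge_add_one_self[of L] by linarith
  then have "real N \<le> 3 * exp L" using Nle lnL by linarith
  then have "ln (real N) \<le> ln (3 * exp L)" using N0 by (intro ln_mono) auto
  also have "\<dots> = ln 3 + L" by (simp add: ln_mult)
  also have "ln 3 \<le> (2::real)" using ln_le_minus_one[of 3] by simp
  finally have lnN: "ln (real N) \<le> 3 * L" using L by simp
  have "A \<le> 1 * (2 * ln (real N) + 1)"
    using divsum_mangoldt_le[OF n N0 Nge, of 1 "\<lambda>_. 1"] N0 by (simp add: A_def frac_le)
  then have A: "A \<le> 7 * L" using lnN L unfolding mult_1 by linarith
  have "F \<le> 4 * (1 + A)" unfolding F_def A_def using n by (rule divsum_one_le)
  then have F: "F \<le> 32 * L" using A L by (simp add: distrib_left)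
  have hN: "smooth_loglog N \<le> 6 * L3"
  proof -
    have "smooth_loglog N \<le> ln (6 * L)"
      unfolding smooth_loglog_def using lnN L N0 by (intro ln_mono three_plus_ln_pos) auto
    also have "\<dots> = ln 6 + ln L" using L by (simp add: ln_mult)
    also have "ln 6 \<le> (5::real)" using ln_le_minus_one[of 6] by simp
    finally show ?thesis using lnL3 L3 by linarith
  qed
  have h0: "0 \<le> smooth_loglog N" using smooth_loglog_ge_1[OF N0] by simp
  have "H \<le> smooth_loglog N * (2 * ln (real N) + 1)"
    unfolding H_def
    by (intro divsum_mangoldt_le n N0 Nge h0 smooth_loglog_mono smooth_loglog_quotient_antimono) auto
  also have "\<dots> \<le> (6 * L3) * (7 * L)"
    using hN h0 lnN L L3 N0 by (intro mult_mono) auto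
  finally have H: "H \<le> 42 * (L * L3)" by (simp add: mult_ac)
  have "ln (3 + A) \<le> ln (10 * L)" using A A0 L by (intro ln_mono) auto
  also have "\<dots> = ln 10 + ln L" using L by (simp add: ln_mult)
  also have "ln 10 \<le> (9::real)" using ln_le_minus_one[of 10] by simp
  finally have l3A: "ln (3 + A) \<le> 10 * L3" using lnL3 L3 by linarith
  have "B \<le> F * ln (3 + A)" unfolding B_def F_def A_def using n by (rule divsum_smooth_loglog_le)
  also have "\<dots> \<le> (32 * L) * (10 * L3)"
    using F l3A A0 L by (intro mult_mono) auto
  finally have B: "B \<le> 320 * (L * L3)" by (simp add: mult_ac)
  have LL: "0 \<le> L * L3" using L L3 by simp
  have "Psi n \<le> B + (H * F + A * B)"
    using Psi_le_divsum[OF n]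
      divsum_ln_mult_le[OF n, where h = smooth_loglog and g = smooth_loglog]
      smooth_loglog_mult_le smooth_loglog_ge_1
    unfolding B_def H_def F_def A_def by (smt (verit))
  also have "\<dots> = (1 + A) * B + H * F" by (simp add: algebra_simps)
  also have "\<dots> \<le> (8 * L) * (320 * (L * L3)) + (42 * (L * L3)) * (32 * L)"
    using A B H F A0 F0 B0 L LL by (intro add_mono mult_mono) auto
  also have "\<dots> = 3904 * (L\<^sup>2 * L3)" by (simp add: power2_eq_square algebra_simps)
  also have "\<dots> \<le> 4000 * (L\<^sup>2 * L3)" using L3 by (intro mult_right_mono) auto
  finally show ?thesis by (simp add: L_def L3_def mult.assoc)
qed


section \<open>The quadratic form\<close>

text \<open>
  An arbitrary positive weight \<open>w\<close> with the series of \<open>1 / (m * w m)\<close> bounded by \<open>S\<close> bounds the form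
  by a diagonal one. After passing to \<open>\<bar>c\<bar>\<close>, the bound of \<open>(k, l)\<^sup>2\<close> by the sum of \<open>d\<^sup>2\<close> over all common
  divisors \<open>d\<close> turns the form into a sum of squares indexed by \<open>d\<close>. The exact identity would have
  Jordan's totient function in place of \<open>d\<^sup>2\<close>, which is of the same size up to a constant.
\<close>

lemma gcd_form_le_weighted:
  fixes w :: "nat \<Rightarrow> real"
  assumes K: "finite K" "\<And>k. k \<in> K \<Longrightarrow> k > 0"
    and w: "\<And>m. m > 0 \<Longrightarrow> w m > 0"
    and S: "\<And>M. finite M \<Longrightarrow> 0 \<notin> M \<Longrightarrow> (\<Sum>m\<in>M. 1 / (real m * w m)) \<le> S"
  shows "gcd_form K c \<le> S * (\<Sum>n\<in>K. (c n)\<^sup>2 * divsum w n)"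
proof -
  define D where "D = (\<Union>k\<in>K. {d. d dvd k})"
  have finD: "finite D" unfolding D_def using K by auto
  define a where "a = (\<lambda>k. \<bar>c k\<bar> / real k)"
  have a0: "0 \<le> a k" for k by (simp add: a_def)
  have gcd_sq: "(real (gcd k l))\<^sup>2 \<le> (\<Sum>d | d \<in> D \<and> (d dvd k \<and> d dvd l). (real d)\<^sup>2)"
    if kl: "k \<in> K" "l \<in> K" for k l
  proof (rule member_le_sum)
    show "gcd k l \<in> {d. d \<in> D \<and> (d dvd k \<and> d dvd l)}" using kl by (auto simp: D_def)
    show "finite {d. d \<in> D \<and> (d dvd k \<and> d dvd l)}" using finD by simp
  qed simp
  have "gcd_form K c \<le> (\<Sum>k\<in>K. \<Sum>l\<in>K. a k * a l * (\<Sum>d | d \<in> D \<and> (d dvd k \<and> d dvd l). (real d)\<^sup>2))"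
    unfolding gcd_form_def
  proof (intro sum_mono)
    fix k l assume kl: "k \<in> K" "l \<in> K"
    have "c k * c l * ((real (gcd k l))\<^sup>2 / (real k * real l)) \<le> \<bar>c k * c l\<bar> * ((real (gcd k l))\<^sup>2 / (real k * real l))"
      by (intro mult_right_mono) auto
    also have "\<dots> = a k * a l * (real (gcd k l))\<^sup>2" by (simp add: a_def abs_mult)
    also have "\<dots> \<le> a k * a l * (\<Sum>d | d \<in> D \<and> (d dvd k \<and> d dvd l). (real d)\<^sup>2)"
      using gcd_sq[OF kl] a0 by (intro mult_left_mono) auto
    finally show "c k * c l * ((real (gcd k l))\<^sup>2 / (real k * real l)) \<le> a k * a l * (\<Sum>d | d \<in> D \<and> (d dvd k \<and> d dvd l). (real d)\<^sup>2)" .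
  qed
  also have "\<dots> = (\<Sum>k\<in>K. \<Sum>l\<in>K. \<Sum>d\<in>D. (if d dvd k then a k * real d else 0) * (if d dvd l then a l * real d else 0))"
  proof (intro sum.cong refl)
    fix k l
    have "(\<Sum>d | d \<in> D \<and> (d dvd k \<and> d dvd l). (real d)\<^sup>2) = (\<Sum>d\<in>D. if d dvd k \<and> d dvd l then (real d)\<^sup>2 else 0)"
      by (rule sum.inter_filter[OF finD])
    then show "a k * a l * (\<Sum>d | d \<in> D \<and> (d dvd k \<and> d dvd l). (real d)\<^sup>2)
       = (\<Sum>d\<in>D. (if d dvd k then a k * real d else 0) * (if d dvd l then a l * real d else 0))"
      by (auto simp: sum_distrib_left power2_eq_square intro!: sum.cong)
  qed
  also have "\<dots> = (\<Sum>k\<in>K. \<Sum>d\<in>D. \<Sum>l\<in>K. (if d dvd k then a k * real d else 0) * (if d dvd l then a l * real d else 0))"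
    by (intro sum.cong refl sum.swap)
  also have "\<dots> = (\<Sum>d\<in>D. \<Sum>k\<in>K. \<Sum>l\<in>K. (if d dvd k then a k * real d else 0) * (if d dvd l then a l * real d else 0))"
    by (rule sum.swap)
  also have "\<dots> = (\<Sum>d\<in>D. (\<Sum>k\<in>K. if d dvd k then a k * real d else 0)\<^sup>2)"
    by (simp only: power2_eq_square sum_product)
  also have "\<dots> = (\<Sum>d\<in>D. (\<Sum>k | k \<in> K \<and> d dvd k. a k * real d)\<^sup>2)"
    using K by (simp add: sum.inter_filter)
  also have "\<dots> \<le> (\<Sum>d\<in>D. S * (\<Sum>k | k \<in> K \<and> d dvd k. (c k)\<^sup>2 * (w (k div d) / real (k div d))))"
  proof (intro sum_mono)
    fix d assume d: "d \<in> D"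
    then have d0: "d > 0" using K by (auto simp: D_def dest: divisor_pos)
    define I where "I = {k \<in> K. d dvd k}"
    have fI: "finite I" using K by (simp add: I_def)
    have m0: "k div d > 0" if "k \<in> I" for k
      using that K d0 by (auto simp: I_def div_greater_zero_iff dvd_imp_le)
    \<comment> \<open>with \<open>k = d * m\<close>, the summand is \<open>\<bar>c k\<bar> / m\<close>, and \<open>1 / m\<close> is split into the square roots of
      \<open>1 / (m * w m)\<close> and \<open>w m / m\<close>\<close>
    have "(\<Sum>k\<in>I. a k * real d)
       = (\<Sum>k\<in>I. sqrt (1 / (real (k div d) * w (k div d))) * (\<bar>c k\<bar> * sqrt (w (k div d) / real (k div d))))"
    proof (intro sum.cong refl)
      fix k assume k: "k \<in> I"
      define m where "m = k div d"
      have km: "k = d * m" using k by (simp add: m_def I_def)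
      have m: "m > 0" using m0[OF k] by (simp add: m_def)
      have wm: "w m > 0" using w m by simp
      have "sqrt (1 / (real m * w m)) * sqrt (w m / real m) = 1 / real m"
        using m wm by (simp add: real_sqrt_mult real_sqrt_divide field_simps)
      moreover have "a k * real d = \<bar>c k\<bar> * (1 / real m)"
        using d0 by (simp add: a_def km)
      ultimately show "a k * real d = sqrt (1 / (real (k div d) * w (k div d))) * (\<bar>c k\<bar> * sqrt (w (k div d) / real (k div d)))"
        unfolding m_def[symmetric] by (simp add: mult_ac)
    qed
    then have "(\<Sum>k\<in>I. a k * real d)\<^sup>2
       \<le> (\<Sum>k\<in>I. (sqrt (1 / (real (k div d) * w (k div d))))\<^sup>2)
          * (\<Sum>k\<in>I. (\<bar>c k\<bar> * sqrt (w (k div d) / real (k div d)))\<^sup>2)"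
      by (simp only: Cauchy_Schwarz_ineq_sum)
    also have "(\<Sum>k\<in>I. (sqrt (1 / (real (k div d) * w (k div d))))\<^sup>2) = (\<Sum>k\<in>I. 1 / (real (k div d) * w (k div d)))"
      using m0 w by (intro sum.cong refl real_sqrt_pow2 divide_nonneg_nonneg mult_nonneg_nonneg) (auto intro: less_imp_le)
    also have "\<dots> = (\<Sum>m\<in>(\<lambda>k. k div d) ` I. 1 / (real m * w m))"
      by (subst sum.reindex) (auto simp: inj_on_def I_def elim!: dvdE)
    also have "\<dots> * (\<Sum>k\<in>I. (\<bar>c k\<bar> * sqrt (w (k div d) / real (k div d)))\<^sup>2)
        \<le> S * (\<Sum>k\<in>I. (\<bar>c k\<bar> * sqrt (w (k div d) / real (k div d)))\<^sup>2)"
      using fI m0 by (intro mult_right_mono S sum_nonneg) force+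
    also have "(\<Sum>k\<in>I. (\<bar>c k\<bar> * sqrt (w (k div d) / real (k div d)))\<^sup>2)
        = (\<Sum>k\<in>I. (c k)\<^sup>2 * (w (k div d) / real (k div d)))"
    proof (intro sum.cong refl)
      fix k assume "k \<in> I"
      then have "0 \<le> w (k div d) / real (k div d)" using m0 w by (simp add: less_imp_le)
      then show "(\<bar>c k\<bar> * sqrt (w (k div d) / real (k div d)))\<^sup>2 = (c k)\<^sup>2 * (w (k div d) / real (k div d))"
        by (simp add: power_mult_distrib del: real_sqrt_divide real_sqrt_eq_iff)
    qed
    finally show "(\<Sum>k | k \<in> K \<and> d dvd k. a k * real d)\<^sup>2
        \<le> S * (\<Sum>k | k \<in> K \<and> d dvd k. (c k)\<^sup>2 * (w (k div d) / real (k div d)))"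
      by (simp add: I_def)
  qed
  also have "\<dots> = S * (\<Sum>d\<in>D. \<Sum>k | k \<in> K \<and> d dvd k. (c k)\<^sup>2 * (w (k div d) / real (k div d)))"
    by (rule sum_distrib_left[symmetric])
  also have "(\<Sum>d\<in>D. \<Sum>k | k \<in> K \<and> d dvd k. (c k)\<^sup>2 * (w (k div d) / real (k div d)))
      = (\<Sum>k\<in>K. \<Sum>d | d \<in> D \<and> d dvd k. (c k)\<^sup>2 * (w (k div d) / real (k div d)))"
    using finD K(1) by (rule sum.swap_restrict)
  also have "(\<Sum>k\<in>K. \<Sum>d | d \<in> D \<and> d dvd k. (c k)\<^sup>2 * (w (k div d) / real (k div d))) = (\<Sum>k\<in>K. (c k)\<^sup>2 * divsum w k)"
  proof (intro sum.cong refl)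
    fix k assume k: "k \<in> K"
    then have k0: "k > 0" using K by simp
    have "{d. d \<in> D \<and> d dvd k} = {d. d dvd k}" using k by (auto simp: D_def)
    moreover have "(\<Sum>d | d dvd k. w (k div d) / real (k div d)) = divsum w k"
      unfolding divsum_def using k0
      by (intro sum.reindex_bij_witness[of _ "\<lambda>d. k div d" "\<lambda>d. k div d"]) auto
    ultimately show "(\<Sum>d | d \<in> D \<and> d dvd k. (c k)\<^sup>2 * (w (k div d) / real (k div d))) = (c k)\<^sup>2 * divsum w k"
      by (simp only: sum_distrib_left[symmetric])
  qed
  finally show ?thesis .
qed


text \<open>
  A series of Bertrand's type. Beyond the truncations the term at \<open>x\<close> is the derivative \<open>G'\<close> of
  \<open>G x = - (ln (ln (ln x))) powr (1 - \<eta>) / (\<eta> - 1)\<close>. As \<open>G'\<close> decreases, the term at \<open>n + 1\<close> is at most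
  \<open>G (n + 1) - G n\<close>, and these differences telescope because \<open>G\<close> tends to \<open>0\<close>.
\<close>

lemma summable_triple_log:
  fixes \<eta> :: real
  assumes "\<eta> > 1"
  shows "summable (\<lambda>m. 1 / (real m * (log1 (real m) * loglog (real m) * logloglog (real m) powr \<eta>)))"
    (is "summable ?f")
proof -
  define G where "G = (\<lambda>x::real. - (ln (ln (ln x)) powr (1 - \<eta>) / (\<eta> - 1)))"
  define G' where "G' = (\<lambda>x::real. 1 / (x * (ln x * ln (ln x) * ln (ln (ln x)) powr \<eta>)))"
  define e3 where "e3 = exp (exp (exp (1::real)))"
  have logs: "e3 < x \<Longrightarrow> 0 < x \<and> 0 < ln x \<and> 0 < ln (ln x) \<and> 0 < ln (ln (ln x)) \<and> exp 1 < x \<and> exp (exp 1) < x" for x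
  proof -
    assume x: "e3 < x"
    have e: "y < exp y" for y :: real using exp_ge_add_one_self[of y] by linarith
    have x0: "0 < x" using x unfolding e3_def by (meson exp_gt_zero order_less_trans)
    have 1: "exp (exp 1) < ln x" using x unfolding e3_def by (rule less_ln_if_exp_less)
    have 10: "0 < ln x" using 1 by (meson exp_gt_zero order_less_trans)
    have 2: "exp 1 < ln (ln x)" using 1 by (rule less_ln_if_exp_less)
    have 20: "0 < ln (ln x)" using 2 by (meson exp_gt_zero order_less_trans)
    have 3: "1 < ln (ln (ln x))" using 2 by (rule less_ln_if_exp_less)
    have "exp (exp 1) < x" "exp 1 < x" using x e[of "exp (exp 1)"] e[of "exp 1"] unfolding e3_def by linarith+
    then show ?thesis using x0 10 20 3 by (intro conjI) linarith+
  qed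
  have deriv: "(G has_real_derivative G' x) (at x)" if x: "e3 < x" for x
  proof -
    note l = logs[OF x]
    have "(G has_real_derivative
        - ((1 - \<eta>) * ln (ln (ln x)) powr (1 - \<eta> - 1) * (1 / ln (ln x) * (1 / ln x * (1 / x))) / (\<eta> - 1))) (at x)"
      unfolding G_def using l assms by (auto intro!: derivative_eq_intros)
    moreover have "- ((1 - \<eta>) * ln (ln (ln x)) powr (1 - \<eta> - 1) * (1 / ln (ln x) * (1 / ln x * (1 / x))) / (\<eta> - 1)) = G' x"
    proof -
      have cancel: "- ((1 - \<eta>) * y / (\<eta> - 1)) = y" for y
      proof -
        have "- ((1 - \<eta>) * y) = (\<eta> - 1) * y" by (simp add: algebra_simps)
        then have "- ((1 - \<eta>) * y / (\<eta> - 1)) = (\<eta> - 1) * y / (\<eta> - 1)"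
          by (simp only: minus_divide_left)
        then show ?thesis using assms by simp
      qed
      show ?thesis
        unfolding mult.assoc[of "1 - \<eta>"] cancel
        using l by (simp add: G'_def powr_minus field_simps)
    qed
    ultimately show ?thesis by simp
  qed
  have f_eq: "?f n = G' (real n)" if "e3 < real n" for n
    using logs[OF that] that by (simp add: G'_def log1_def loglog_def logloglog_def e3_def)
  have step: "?f (Suc n) \<le> G (real (Suc n)) - G (real n)" if n: "e3 < real n" for n
  proof -
    have "\<exists>z. real n < z \<and> z < real (Suc n) \<and> G (real (Suc n)) - G (real n) = (real (Suc n) - real n) * G' z"
      using n by (intro MVT2 deriv) auto
    then obtain z where z: "real n < z" "z < real (Suc n)" and Gz: "G (real (Suc n)) - G (real n) = G' z"
      by auto
    have ez: "e3 < z" "e3 < real (Suc n)" using n z by linarith+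
    note l = logs[OF ez(1)] logs[OF ez(2)]
    have le: "ln z \<le> ln (real (Suc n))" using z l by (intro ln_mono) auto
    then have le2: "ln (ln z) \<le> ln (ln (real (Suc n)))" using l by (intro ln_mono) auto
    then have "ln (ln (ln z)) \<le> ln (ln (ln (real (Suc n))))" using l by (intro ln_mono) auto
    then have le3: "ln (ln (ln z)) powr \<eta> \<le> ln (ln (ln (real (Suc n)))) powr \<eta>"
      using l assms by (intro powr_mono2) auto
    have "G' (real (Suc n)) \<le> G' z"
      unfolding G'_def
    proof (rule divide_left_mono)
      show "z * (ln z * ln (ln z) * ln (ln (ln z)) powr \<eta>)
          \<le> real (Suc n) * (ln (real (Suc n)) * ln (ln (real (Suc n))) * ln (ln (ln (real (Suc n)))) powr \<eta>)"
        using l z le le2 le3 by (intro mult_mono) auto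
      show "0 < real (Suc n) * (ln (real (Suc n)) * ln (ln (real (Suc n))) * ln (ln (ln (real (Suc n)))) powr \<eta>)
          * (z * (ln z * ln (ln z) * ln (ln (ln z)) powr \<eta>))"
        using l by (intro mult_pos_pos) auto
    qed simp
    then show ?thesis using f_eq[OF ez(2)] Gz by simp
  qed
  have "filterlim (\<lambda>n. ln (ln (ln (real n)))) at_top sequentially"
    by (intro filterlim_compose[OF ln_at_top] filterlim_real_sequentially)
  then have "(\<lambda>n. ln (ln (ln (real n))) powr (1 - \<eta>)) \<longlonglongrightarrow> 0"
    using assms by (intro tendsto_neg_powr) auto
  then have "(\<lambda>n. - (ln (ln (ln (real n))) powr (1 - \<eta>) / (\<eta> - 1))) \<longlonglongrightarrow> - (0 / (\<eta> - 1))"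
    using assms by (intro tendsto_intros) auto
  then have "summable (\<lambda>n. G (real (Suc n)) - G (real n))"
    unfolding G_def by (rule telescope_summable)
  moreover have "eventually (\<lambda>n. norm (?f (Suc n)) \<le> G (real (Suc n)) - G (real n)) sequentially"
  proof -
    have "eventually (\<lambda>n. e3 < real n) sequentially"
      using filterlim_real_sequentially by (simp add: filterlim_at_top_dense)
    then show ?thesis
    proof eventually_elim
      case (elim n)
      have "0 < log1 (real (Suc n))" "0 < loglog (real (Suc n))" "0 < logloglog (real (Suc n)) powr \<eta>"
        using log1_ge_1[of "real (Suc n)"] loglog_ge_1[of "real (Suc n)"] logloglog_ge_1[of "real (Suc n)"]
        by auto
      then have "0 \<le> ?f (Suc n)" by simp
      then show ?case using step[OF elim] by simp
    qed
  qed
  ultimately have "summable (\<lambda>n. ?f (Suc n))" by (rule summable_comparison_test_ev[rotated])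
  then show ?thesis using summable_Suc_iff[of ?f] by blast
qed

text \<open>
  The weight is chosen so that its first two factors are exactly those in \<open>Psi\<close>; the third one is
  nondecreasing and is taken out of the divisor sum.
\<close>

theorem theorem5p1:
  fixes \<eta> :: real
  assumes "\<eta> > 1"
  shows "(\<exists>C>0. \<forall>(K :: nat set) (c :: nat \<Rightarrow> real).
            finite K \<and> (\<forall>k\<in>K. k > 0) \<longrightarrow>
            gcd_form K c \<le> C * (\<Sum>n\<in>K. (c n)\<^sup>2 * logloglog (real n) powr \<eta> * Psi n))
       \<and> (\<exists>C>0. \<forall>(K :: nat set) (c :: nat \<Rightarrow> real).
            finite K \<and> (\<forall>k\<in>K. k > 0) \<longrightarrow>
            gcd_form K c \<le> C * (\<Sum>n\<in>K. (c n)\<^sup>2 * (loglog (real n))\<^sup>2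
                                          * logloglog (real n) powr (1 + \<eta>)))"
proof -
  define w where "w = (\<lambda>m. log1 (real m) * loglog (real m) * logloglog (real m) powr \<eta>)"
  have log1_pos: "0 < log1 x" for x using log1_ge_1[of x] by linarith
  have loglog_pos: "0 < loglog x" for x using loglog_ge_1[of x] by linarith
  have logloglog_pos: "0 < logloglog x" for x using logloglog_ge_1[of x] by linarith
  have w_pos: "w m > 0" for m
    unfolding w_def using log1_pos[of "real m"] loglog_pos[of "real m"] logloglog_pos[of "real m"] by simp
  define S where "S = (\<Sum>m. 1 / (real m * w m)) + 1"
  have summ: "summable (\<lambda>m. 1 / (real m * w m))"
    unfolding w_def using assms by (rule summable_triple_log)
  have term_nonneg: "0 \<le> 1 / (real m * w m)" for m
    using w_pos[of m] by (cases "m = 0") (auto intro!: divide_nonneg_nonneg less_imp_le)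
  have partial: "(\<Sum>m\<in>M. 1 / (real m * w m)) \<le> S" if "finite M" for M
    using sum_le_suminf[OF summ that] term_nonneg by (simp add: S_def add_increasing2)
  have S: "S > 0" unfolding S_def using suminf_nonneg[OF summ term_nonneg] by simp
  have w_sum: "divsum w n \<le> logloglog (real n) powr \<eta> * Psi n" if n: "n > 0" for n
  proof -
    have "divsum w n \<le> divsum (\<lambda>m. logloglog (real n) powr \<eta> * (log1 (real m) * loglog (real m))) n"
    proof (rule divsum_mono)
      fix m assume m: "m dvd n"
      then have m0: "m > 0" and "m \<le> n" using n by (auto intro: dvd_imp_le divisor_pos)
      then have "logloglog (real m) powr \<eta> \<le> logloglog (real n) powr \<eta>"
        using assms logloglog_pos[of "real m"] by (intro powr_mono2 logloglog_mono) auto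
      then show "w m \<le> logloglog (real n) powr \<eta> * (log1 (real m) * loglog (real m))"
        unfolding w_def using log1_pos[of "real m"] loglog_pos[of "real m"]
        by (subst mult.commute) (intro mult_right_mono, auto)
    qed
    also have "\<dots> = logloglog (real n) powr \<eta> * Psi n"
      by (simp only: divsum_scale) (simp add: divsum_def Psi_def)
    finally show ?thesis .
  qed
  have first: "gcd_form K c \<le> S * (\<Sum>n\<in>K. (c n)\<^sup>2 * logloglog (real n) powr \<eta> * Psi n)"
    if K: "finite K" "\<forall>k\<in>K. k > 0" for K c
  proof -
    have "gcd_form K c \<le> S * (\<Sum>n\<in>K. (c n)\<^sup>2 * divsum w n)"
      using K w_pos partial by (intro gcd_form_le_weighted) auto
    also have "\<dots> \<le> S * (\<Sum>n\<in>K. (c n)\<^sup>2 * (logloglog (real n) powr \<eta> * Psi n))"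
      using K S by (intro mult_left_mono sum_mono w_sum) auto
    finally show ?thesis by (simp add: mult.assoc)
  qed
  have second: "gcd_form K c \<le> (4000 * S) * (\<Sum>n\<in>K. (c n)\<^sup>2 * (loglog (real n))\<^sup>2 * logloglog (real n) powr (1 + \<eta>))"
    if K: "finite K" "\<forall>k\<in>K. k > 0" for K c
  proof -
    have "gcd_form K c \<le> S * (\<Sum>n\<in>K. (c n)\<^sup>2 * logloglog (real n) powr \<eta> * Psi n)"
      using K by (rule first)
    also have "\<dots> \<le> S * (\<Sum>n\<in>K. (c n)\<^sup>2 * logloglog (real n) powr \<eta> * (4000 * (loglog (real n))\<^sup>2 * logloglog (real n)))"
      using K S by (intro mult_left_mono sum_mono Psi_le) auto
    also have "\<dots> = S * (\<Sum>n\<in>K. 4000 * ((c n)\<^sup>2 * (loglog (real n))\<^sup>2 * logloglog (real n) powr (1 + \<eta>)))"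
    proof -
      have "logloglog (real n) powr (1 + \<eta>) = logloglog (real n) * logloglog (real n) powr \<eta>" for n
        using logloglog_pos[of "real n"] by (simp add: powr_add)
      then show ?thesis by (simp add: mult_ac)
    qed
    finally show ?thesis by (simp add: sum_distrib_left mult.assoc mult.left_commute)
  qed
  show ?thesis
    using S first second by (intro conjI exI[of _ S] exI[of _ "4000 * S"]) auto
qed

end
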